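(* Let $M$ be a square $\{0,1\}$-matrix with exactly $k$ diagonal entries equal to $0$ and exactly $\ell$ diagonal entries equal to $1$. If $D$ is a minimal $M$-obstruction, then $|V(D)| \le (k+1)(\ell+1)$.
   Context: Digraphs $D$ are finite, without loops and without multiple arcs. A strong clique of $D$ is a set $C$ of vertices such that for any two distinct $x,y\in C$ both $(x,y)$ and $(y,x)$ are arcs; an independent set is a set $I$ such that for any two vertices $x,y\in I$ neither $(x,y)$ nor $(y,x)$ is an arc. For disjoint vertex sets $S,S'$, $S$ is completely adjacent to $S'$ if $(x,x')$ is an arc for all $x\in S,x'\in S'$, and completely non-adjacent to $S'$ if $(x,x')$ is an arc for no $x\in S,x'\in S'$. For a $(k+\ell)\times(k+\ell)$ $\{0,1\}$-matrix $M$ (rows/columns indexed $1,\dots,k+\ell$), an $M$-partition of $D$ is a partition of $V(D)$ into (possibly empty) parts $V_1,\dots,V_{k+\ell}$ such that $V_i$ is independent if $M(i,i)=0$, $V_i$ is a strong clique if $M(i,i)=1$, and for $i\neq j$, $V_i$ is completely non-adjacent to $V_j$ if $M(i,j)=0$ and completely adjacent to $V_j$ if $M(i,j)=1$. A minimal $M$-obstruction is a digraph $D$ that admits no $M$-partition but such that $D-v$ admits an $M$-partition for every vertex $v$ of $D$. *)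

theory Defs
  imports "Graph_Theory.Digraph" "Jordan_Normal_Form.Matrix"
begin

text \<open>
  Finite digraphs without loops and without multiple arcs are those satisfying the library
  predicate \<^const>\<open>digraph\<close>; "\<open>(x, y)\<close> is an arc" is \<open>(x, y) \<in> arcs_ends D\<close>.
  The null digraph is allowed.
\<close>

definition strong_clique :: "('a, 'b) pre_digraph \<Rightarrow> 'a set \<Rightarrow> bool" where
  "strong_clique D C \<longleftrightarrow> C \<subseteq> verts D \<and>
     (\<forall>x\<in>C. \<forall>y\<in>C. x \<noteq> y \<longrightarrow> (x, y) \<in> arcs_ends D \<and> (y, x) \<in> arcs_ends D)"

definition independent_set :: "('a, 'b) pre_digraph \<Rightarrow> 'a set \<Rightarrow> bool" where
  "independent_set D I \<longleftrightarrow> I \<subseteq> verts D \<and>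
     (\<forall>x\<in>I. \<forall>y\<in>I. (x, y) \<notin> arcs_ends D \<and> (y, x) \<notin> arcs_ends D)"

definition completely_adjacent :: "('a, 'b) pre_digraph \<Rightarrow> 'a set \<Rightarrow> 'a set \<Rightarrow> bool" where
  "completely_adjacent D S S' \<longleftrightarrow> (\<forall>x\<in>S. \<forall>x'\<in>S'. (x, x') \<in> arcs_ends D)"

definition completely_nonadjacent :: "('a, 'b) pre_digraph \<Rightarrow> 'a set \<Rightarrow> 'a set \<Rightarrow> bool" where
  "completely_nonadjacent D S S' \<longleftrightarrow> (\<forall>x\<in>S. \<forall>x'\<in>S'. (x, x') \<notin> arcs_ends D)"

definition zero_one_mat :: "nat mat \<Rightarrow> bool" where
  "zero_one_mat M \<longleftrightarrow> (\<forall>i<dim_row M. \<forall>j<dim_col M. M $$ (i, j) \<in> {0, 1})"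

text \<open>
  Rows, columns and parts are indexed from 0. Only the parts \<open>V i\<close> with \<open>i < dim_row M\<close> matter,
  and they may be empty.
\<close>

definition M_partition :: "nat mat \<Rightarrow> ('a, 'b) pre_digraph \<Rightarrow> (nat \<Rightarrow> 'a set) \<Rightarrow> bool" where
  "M_partition M D V \<longleftrightarrow>
     (\<Union>i<dim_row M. V i) = verts D \<and>
     disjoint_family_on V {..<dim_row M} \<and>
     (\<forall>i<dim_row M.
        (M $$ (i, i) = 0 \<longrightarrow> independent_set D (V i)) \<and>
        (M $$ (i, i) = 1 \<longrightarrow> strong_clique D (V i))) \<and>
     (\<forall>i<dim_row M. \<forall>j<dim_row M. i \<noteq> j \<longrightarrow>
        (M $$ (i, j) = 0 \<longrightarrow> completely_nonadjacent D (V i) (V j)) \<and>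
        (M $$ (i, j) = 1 \<longrightarrow> completely_adjacent D (V i) (V j)))"

definition M_partitionable :: "nat mat \<Rightarrow> ('a, 'b) pre_digraph \<Rightarrow> bool" where
  "M_partitionable M D \<longleftrightarrow> (\<exists>V. M_partition M D V)"

definition minimal_M_obstruction :: "nat mat \<Rightarrow> ('a, 'b) pre_digraph \<Rightarrow> bool" where
  "minimal_M_obstruction M D \<longleftrightarrow> digraph D \<and> \<not> M_partitionable M D \<and>
     (\<forall>v\<in>verts D. M_partitionable M (pre_digraph.del_vert D v))"

end

theory Submission
  imports Defs
begin

text \<open>
  Two vertices lying in one part of an \<open>M\<close>-partition are twins: they are related in the same way to
  every other vertex, and are non-adjacent (type 0) or adjacent both ways (type 1). In a minimal
  obstruction \<open>D\<close>, a partition of \<open>D - v\<close> never puts a type \<open>b\<close> twin of \<open>v\<close> into a part of type \<open>b\<close>,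
  since \<open>v\<close> could join it there; hence all type \<open>b\<close> twins of \<open>v\<close> lie in different parts of the other
  type. If \<open>v\<close> lies in a largest twin class of type \<open>b\<close>, of size \<open>p\<close>, and deleting \<open>v\<close> creates no new
  twins, then counting the parts of \<open>D - v\<close> gives the bound: with \<open>m\<close> parts of type \<open>b\<close>, \<open>n\<close> parts of the
  other type and \<open>q\<close> the largest size of a twin class of the other type,
  \<open>|V| - 1 \<le> (p - 1) + (n - (p - 1)) q + m p\<close>, where \<open>p \<le> n + 1\<close> and \<open>q \<le> m + 1\<close>.

  If deleting a vertex \<open>v\<close> that has a twin \<open>v'\<close> does create new twins, then \<open>{v, v'}\<close> is a full twin
  class and \<open>v'\<close> becomes a twin, of the other type, of a vertex without twins in \<open>D\<close>. The bound then
  follows by refining the count, the extremal case being that all vertices but one have twins.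
  If \<open>D\<close> has no twins at all, an argument in the style of Bondy's theorem on distinct
  rows of a matrix yields a vertex whose deletion creates no twins of type 1. Its new twin classes of
  type 0 have size at most 2, since from a larger one a vertex can be deleted creating no twins at all.
\<close>

section \<open>Twins\<close>

definition twins :: "('a \<Rightarrow> 'a \<Rightarrow> bool) \<Rightarrow> bool \<Rightarrow> 'a set \<Rightarrow> 'a \<Rightarrow> 'a \<Rightarrow> bool" where
  "twins E b W x y \<longleftrightarrow> x \<in> W \<and> y \<in> W \<and> x \<noteq> y \<and> E x y = b \<and> E y x = b \<and>
     (\<forall>z\<in>W - {x, y}. E x z = E y z \<and> E z x = E z y)"

lemma twins_sym: "twins E b W x y \<Longrightarrow> twins E b W y x"
  by (auto simp: twins_def)

lemma twins_trans:
  "twins E b W x y \<Longrightarrow> twins E b W y z \<Longrightarrow> x \<noteq> z \<Longrightarrow> twins E b W x z"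
  unfolding twins_def by (cases "E x y"; cases "E y z"; auto; blast)

lemma twins_exclusive: "twins E b W x y \<Longrightarrow> twins E (\<not> b) W x z \<Longrightarrow> False"
  unfolding twins_def by (metis DiffI empty_iff insert_iff)

lemma new_twins_separated:
  assumes "twins E c (W - {v}) x y" "\<not> twins E c W x y"
  shows "E x v \<noteq> E y v \<or> E v x \<noteq> E v y"
proof -
  have *: "u = v" if "u \<in> W - {x, y}" "E x u \<noteq> E y u \<or> E u x \<noteq> E u y" for u
    using assms(1) that unfolding twins_def by blast
  obtain u where "u \<in> W - {x, y}" "E x u \<noteq> E y u \<or> E u x \<noteq> E u y"
    using assms unfolding twins_def by blast
  then show ?thesis using * by blast
qed

text \<open>Bondy's theorem for the rows \<open>r x\<close> of a matrix with columns \<open>V\<close>.\<close>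

lemma separating_columns:
  assumes "finite X" "X \<noteq> {}"
    and "\<And>x y. x \<in> X \<Longrightarrow> y \<in> X \<Longrightarrow> x \<noteq> y \<Longrightarrow> \<exists>z\<in>V. r x z \<noteq> r y z"
  shows "\<exists>S\<subseteq>V. finite S \<and> card S < card X \<and> (\<forall>x\<in>X. \<forall>y\<in>X. x \<noteq> y \<longrightarrow> (\<exists>z\<in>S. r x z \<noteq> r y z))"
  using assms
proof (induction X rule: finite_ne_induct)
  case (singleton x)
  show ?case by (rule exI[of _ "{}"]) auto
next
  case (insert x X)
  then obtain S where S: "S \<subseteq> V" "finite S" "card S < card X"
    and sep: "\<And>x y. x \<in> X \<Longrightarrow> y \<in> X \<Longrightarrow> x \<noteq> y \<Longrightarrow> \<exists>z\<in>S. r x z \<noteq> r y z"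
    by (metis insert_iff)
  show ?case
  proof (cases "\<exists>y\<in>X. \<forall>z\<in>S. r x z = r y z")
    case True
    then obtain y where y: "y \<in> X" "\<And>z. z \<in> S \<Longrightarrow> r x z = r y z" by blast
    with insert.hyps insert.prems obtain z where z: "z \<in> V" "r x z \<noteq> r y z" by (metis insert_iff)
    have "\<exists>z'\<in>insert z S. r x z' \<noteq> r u z'" if "u \<in> X" for u
      using y z sep[of y u] that by (cases "u = y") auto
    then have "\<forall>x'\<in>insert x X. \<forall>y'\<in>insert x X. x' \<noteq> y' \<longrightarrow> (\<exists>z'\<in>insert z S. r x' z' \<noteq> r y' z')"
      using sep by (metis insert_iff)
    moreover have "card (insert z S) < card (insert x X)"
      using S insert.hyps by (simp add: card_insert_if)
    ultimately show ?thesis using S z by (intro exI[of _ "insert z S"]) auto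
  next
    case False
    then have "\<forall>x'\<in>insert x X. \<forall>y'\<in>insert x X. x' \<noteq> y' \<longrightarrow> (\<exists>z'\<in>S. r x' z' \<noteq> r y' z')"
      using sep by (metis insert_iff)
    then show ?thesis using S insert.hyps by (intro exI[of _ S]) auto
  qed
qed

lemma exists_vertex_creating_no_twins:
  assumes "finite V" "V \<noteq> {}" and no: "\<And>x y. \<not> twins E c V x y"
  shows "\<exists>v\<in>V. \<forall>x y. \<not> twins E c (V - {v}) x y"
proof -
  define B where "B x z = (if x = z then c else E x z)" for x z
  define r where "r x z = (B x z, B z x)" for x z
  have tw: "twins E c W x y \<longleftrightarrow> x \<in> W \<and> y \<in> W \<and> x \<noteq> y \<and> (\<forall>z\<in>W. r x z = r y z)" for W x y
  proof -
    have "(\<forall>z\<in>W. r x z = r y z) \<longleftrightarrow> E x y = c \<and> E y x = c \<and> (\<forall>z\<in>W - {x, y}. E x z = E y z \<and> E z x = E z y)"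
      if "x \<in> W" "y \<in> W" "x \<noteq> y"
    proof -
      have "(\<forall>z\<in>W. r x z = r y z) \<longleftrightarrow> r x x = r y x \<and> r x y = r y y \<and> (\<forall>z\<in>W - {x, y}. r x z = r y z)"
        using that by blast
      moreover have "r x z = r y z \<longleftrightarrow> E x z = E y z \<and> E z x = E z y" if "z \<in> W - {x, y}" for z
      proof -
        have "x \<noteq> z" "y \<noteq> z" using that by blast+
        then show ?thesis by (simp add: r_def B_def)
      qed
      moreover have "r x x = r y x \<and> r x y = r y y \<longleftrightarrow> E x y = c \<and> E y x = c"
        using that by (simp add: r_def B_def) metis
      ultimately show ?thesis by (metis (no_types, lifting))
    qed
    then show ?thesis unfolding twins_def by blast
  qed
  have "\<exists>S\<subseteq>V. finite S \<and> card S < card V \<and> (\<forall>x\<in>V. \<forall>y\<in>V. x \<noteq> y \<longrightarrow> (\<exists>z\<in>S. r x z \<noteq> r y z))"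
  proof (rule separating_columns)
    show "\<exists>z\<in>V. r x z \<noteq> r y z" if "x \<in> V" "y \<in> V" "x \<noteq> y" for x y
      using no[of x y] that unfolding tw by simp
  qed (use assms in auto)
  then obtain S where S: "S \<subseteq> V" "card S < card V"
    and sep: "\<And>x y. x \<in> V \<Longrightarrow> y \<in> V \<Longrightarrow> x \<noteq> y \<Longrightarrow> \<exists>z\<in>S. r x z \<noteq> r y z" by blast
  have "V - S \<noteq> {}" using S by auto
  then obtain v where "v \<in> V - S" by blast
  then have "\<not> twins E c (V - {v}) x y" for x y
    using S(1) sep[of x y] unfolding tw by blast
  then show ?thesis using \<open>v \<in> V - S\<close> by blast
qed

lemma exists_irrelevant_vertex:
  assumes no: "\<And>d x y. \<not> twins E d V x y"
    and "finite Q" "3 \<le> card Q" and Q: "\<And>x y. x \<in> Q \<Longrightarrow> y \<in> Q \<Longrightarrow> x \<noteq> y \<Longrightarrow> twins E c (V - {v}) x y"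
  shows "\<exists>x\<in>V. \<forall>d y z. \<not> twins E d (V - {x}) y z"
proof -
  have sep: "E x v \<noteq> E y v \<or> E v x \<noteq> E v y" if "x \<in> Q" "y \<in> Q" "x \<noteq> y" for x y
    using new_twins_separated[OF Q[OF that] no] .
  have Q_ne: "Q \<noteq> {}" using assms by auto
  \<comment> \<open>A vertex of \<open>Q\<close> joined to \<open>v\<close> like the members of \<open>Q\<close> to each other must be the deleted one:
    without it, \<open>v\<close> cannot become a twin of a member of \<open>Q\<close>.\<close>
  have "\<exists>x\<in>Q. \<forall>x'\<in>Q - {x}. \<not> (E x' v = c \<and> E v x' = c)"
  proof (cases "\<exists>x\<in>Q. E x v = c \<and> E v x = c")
    case True
    then obtain x where x: "x \<in> Q" "E x v = c" "E v x = c" by blast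
    have "\<not> (E x' v = c \<and> E v x' = c)" if "x' \<in> Q - {x}" for x'
      using sep[of x x'] that x by blast
    then show ?thesis using x by blast
  next
    case False
    then show ?thesis using Q_ne by blast
  qed
  then obtain x where x: "x \<in> Q" and xcc: "\<And>x'. x' \<in> Q - {x} \<Longrightarrow> \<not> (E x' v = c \<and> E v x' = c)"
    by blast
  have other: "\<exists>x'. x' \<in> Q - {x, y}" for y
  proof -
    have "card {x, y} < card Q" using assms by (simp add: card_insert_if)
    then have "\<not> Q \<subseteq> {x, y}" using card_mono[of "{x, y}" Q] by auto
    then show ?thesis by blast
  qed
  have Qtw: "E y z = E x z" "E z y = E z x" if "y \<in> Q" "z \<in> V" "z \<noteq> v" "z \<noteq> x" "z \<noteq> y" for y z
  proof -
    have "(y = x \<or> twins E c (V - {v}) y x) \<and> z \<in> V - {v}" using Q that x by blast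
    then show "E y z = E x z" "E z y = E z x" using that unfolding twins_def
      by (metis Diff_iff insert_iff singletonD)+
  qed
  have Qc: "y \<in> V" "y \<noteq> v" "E y z = c" if "y \<in> Q" "z \<in> Q" "y \<noteq> z" for y z
    using Q[OF that] by (simp_all add: twins_def)
  have xV: "x \<in> V" "x \<noteq> v" using Qc[of x] other[of x] x by blast+
  have aux: False if yz: "twins E d (V - {x}) y z" and y: "y \<in> Q" for d y z
  proof -
    have y': "y \<noteq> x" "z \<noteq> x" "y \<noteq> z" "z \<in> V" "y \<in> V" "E y z = d" "E z y = d"
      using yz by (simp_all add: twins_def)
    have s: "E y x \<noteq> E z x \<or> E x y \<noteq> E x z" using new_twins_separated[OF yz no] .
    obtain x' where x': "x' \<in> Q" "x' \<noteq> x" "x' \<noteq> y" using other[of y] by blast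
    have zQ: "z \<notin> Q" using s Qc(3)[of y x] Qc(3)[of x y] Qc(3)[of z x] Qc(3)[of x z] y y' x by blast
    have "x' \<in> V - {x} - {y, z}" using Qc[of x' x] x x' zQ by blast
    then have zx': "E z x' = c" "E x' z = c"
      using yz Qc(3)[of y x'] Qc(3)[of x' y] x' y unfolding twins_def by blast+
    have "z \<noteq> v" using zx' xcc[of x'] x' by blast
    then have "E x' z = E x z" "E z x' = E z x" using Qtw[of x' z] x' y' zQ by blast+
    then show False using s zx' Qc(3)[of y x] Qc(3)[of x y] y y' x by blast
  qed
  have aux2: False if yz: "twins E d (V - {x}) v z" and z: "z \<notin> Q" for d z
  proof -
    have z': "z \<noteq> x" "z \<noteq> v" "z \<in> V" using yz by (auto simp: twins_def)
    obtain x' where x': "x' \<in> Q" "x' \<noteq> x" using other[of x] by blast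
    obtain x'' where x'': "x'' \<in> Q" "x'' \<noteq> x" "x'' \<noteq> x'" using other[of x'] by blast
    have "E u v = E x z \<and> E v u = E z x" if u: "u \<in> Q" "u \<noteq> x" for u
    proof -
      have "u \<in> V - {x} - {v, z}" using Qc[of u x] u x z by blast
      then have "E v u = E z u" "E u v = E u z" using yz unfolding twins_def by blast+
      moreover have "z \<noteq> u" using u z by blast
      ultimately show ?thesis using Qtw[of u z] u z' by simp
    qed
    then show False using sep[of x' x''] x' x'' by simp
  qed
  have "\<not> twins E d (V - {x}) y z" for d y z
  proof
    assume yz: "twins E d (V - {x}) y z"
    have s: "E y x \<noteq> E z x \<or> E x y \<noteq> E x z" using new_twins_separated[OF yz no] .
    have nQ: "y \<notin> Q" "z \<notin> Q" using aux[OF yz] aux[OF twins_sym[OF yz]] by blast+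
    have nv: "y \<noteq> v" "z \<noteq> v" using aux2[of d z] aux2[of d y] nQ yz twins_sym[OF yz] by blast+
    have V: "y \<in> V" "z \<in> V" "y \<noteq> x" "z \<noteq> x" using yz by (simp_all add: twins_def)
    obtain x' where x': "x' \<in> Q" "x' \<noteq> x" using other[of x] by blast
    have n: "x' \<noteq> y" "x' \<noteq> z" using nQ x' by blast+
    have "x' \<in> V - {x} - {y, z}" using Qc[of x' x] x x' n by blast
    then have "E y x' = E z x'" "E x' y = E x' z" using yz unfolding twins_def by blast+
    then show False using s Qtw[of x' y] Qtw[of x' z] x' n nv V by simp
  qed
  then show ?thesis using xV by blast
qed

lemma add_le_mult_add_1:
  fixes k l :: nat assumes "1 \<le> k" "1 \<le> l" shows "k + l \<le> k * l + 1"
proof -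
  obtain k' l' where "k = Suc k'" "l = Suc l'" using assms by (metis One_nat_def Suc_le_D)
  then show ?thesis by simp
qed

lemma sum_le_card_mult: "(\<And>i. i \<in> A \<Longrightarrow> f i \<le> m) \<Longrightarrow> sum f A \<le> card A * (m :: nat)"
  using sum_bounded_above[of A f m] by simp

lemma card_bound_arith:
  fixes k l p q n :: nat
  assumes "n \<le> p + ((l - (p - 1)) * q + k * p)" "1 \<le> p" "p \<le> l + 1" "1 \<le> q" "q \<le> k + 1"
  shows "n \<le> (k + 1) * (l + 1)"
proof -
  obtain x y where p: "p = Suc x" and q: "q = Suc y" using assms by (metis Suc_le_D One_nat_def)
  then obtain i j where "l = x + i" "k = y + j" using assms by (metis Suc_eq_plus1 Suc_le_mono le_iff_add)
  then show ?thesis using assms(1) p q by (simp add: algebra_simps)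
qed

section \<open>Colourings of vertex-deleted subgraphs\<close>

text \<open>
  \<open>I b\<close> is the set of parts of type \<open>b\<close>. Of the matrix, only the two consequences in the last
  assumption are needed: vertices in one part are twins, and the deleted vertex
  has no twin in a part of the matching type.
\<close>

locale obstruction =
  fixes E :: "'a \<Rightarrow> 'a \<Rightarrow> bool" and V :: "'a set" and I :: "bool \<Rightarrow> 'i set"
  assumes finite_V: "finite V" and finite_I: "finite (I b)" and disjoint_I: "I True \<inter> I False = {}"
    and ex_colouring: "v \<in> V \<Longrightarrow> \<exists>f. (\<forall>x\<in>V - {v}. \<exists>b. f x \<in> I b) \<and>
      (\<forall>b x y. f x \<in> I b \<longrightarrow> f x = f y \<longrightarrow> x \<in> V - {v} \<longrightarrow> y \<in> V - {v} \<longrightarrow> x \<noteq> y \<longrightarrow> twins E b (V - {v}) x y) \<and>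
      (\<forall>b x. x \<in> V - {v} \<longrightarrow> f x \<in> I b \<longrightarrow> \<not> twins E b V v x)"
begin

abbreviation "tw \<equiv> twins E"

definition colouring :: "'a \<Rightarrow> ('a \<Rightarrow> 'i) \<Rightarrow> bool" where
  "colouring v f \<longleftrightarrow> v \<in> V \<and> (\<forall>x\<in>V - {v}. \<exists>b. f x \<in> I b) \<and>
      (\<forall>b x y. f x \<in> I b \<longrightarrow> f x = f y \<longrightarrow> x \<in> V - {v} \<longrightarrow> y \<in> V - {v} \<longrightarrow> x \<noteq> y \<longrightarrow> tw b (V - {v}) x y) \<and>
      (\<forall>b x. x \<in> V - {v} \<longrightarrow> f x \<in> I b \<longrightarrow> \<not> tw b V v x)"

definition fibre :: "'a \<Rightarrow> ('a \<Rightarrow> 'i) \<Rightarrow> 'i \<Rightarrow> 'a set" where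
  "fibre v f i = {x \<in> V - {v}. f x = i}"

definition twin_class :: "bool \<Rightarrow> 'a \<Rightarrow> 'a set" where
  "twin_class b x = insert x {y. tw b V x y}"

lemma obtain_colouring:
  assumes "v \<in> V" obtains f where "colouring v f"
  using ex_colouring[OF assms] assms unfolding colouring_def by blast

lemma finite_fibre: "finite (fibre v f i)"
  using finite_V by (simp add: fibre_def)

lemma twin_class_subset: "x \<in> V \<Longrightarrow> twin_class b x \<subseteq> V"
  by (auto simp: twin_class_def twins_def)

lemma finite_twin_class: "x \<in> V \<Longrightarrow> finite (twin_class b x)"
  using twin_class_subset finite_V finite_subset by metis

lemma not_in_both_I: "i \<in> I b \<Longrightarrow> i \<in> I (\<not> b) \<Longrightarrow> False"
  using disjoint_I by (cases b) auto

lemma colouring_cases: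
  assumes "colouring v f" "x \<in> V - {v}"
  obtains "f x \<in> I b" | "f x \<in> I (\<not> b)"
proof -
  obtain c where "f x \<in> I c" using assms unfolding colouring_def by blast
  then show ?thesis using that by (cases "c = b") auto
qed

lemma colouring_twins:
  "colouring v f \<Longrightarrow> f x \<in> I b \<Longrightarrow> f x = f y \<Longrightarrow> x \<in> V - {v} \<Longrightarrow> y \<in> V - {v} \<Longrightarrow> x \<noteq> y \<Longrightarrow> tw b (V - {v}) x y"
  by (auto simp: colouring_def)

lemma colouring_twin_of_deleted:
  assumes "colouring v f" "tw b V v x" shows "f x \<in> I (\<not> b)"
proof -
  have "x \<in> V - {v}" using assms by (auto simp: twins_def)
  with assms show ?thesis by (metis colouring_cases colouring_def)
qed

lemma card_V:
  assumes "colouring v f"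
  shows "card V = Suc ((\<Sum>i\<in>I b. card (fibre v f i)) + (\<Sum>i\<in>I (\<not> b). card (fibre v f i)))"
proof -
  have "V - {v} = (\<Union>i\<in>I b \<union> I (\<not> b). fibre v f i)"
    using colouring_cases[OF assms, of _ b] by (auto simp: fibre_def)
  moreover have "card (\<Union>i\<in>I b \<union> I (\<not> b). fibre v f i) = (\<Sum>i\<in>I b \<union> I (\<not> b). card (fibre v f i))"
    by (intro card_UN_disjoint) (auto simp: finite_I finite_fibre, auto simp: fibre_def)
  ultimately have "card (V - {v}) = (\<Sum>i\<in>I b \<union> I (\<not> b). card (fibre v f i))"
    by simp
  also have "\<dots> = (\<Sum>i\<in>I b. card (fibre v f i)) + (\<Sum>i\<in>I (\<not> b). card (fibre v f i))"
    using not_in_both_I by (intro sum.union_disjoint finite_I) blast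
  finally show ?thesis using assms finite_V card_Suc_Diff1[of V v] by (simp add: colouring_def)
qed

lemma fibre_subset:
  assumes "colouring v f" "x \<in> fibre v f i" "i \<in> I b"
  shows "fibre v f i \<subseteq> insert x {y. tw b (V - {v}) x y}"
proof
  fix y assume y: "y \<in> fibre v f i"
  have "tw b (V - {v}) x y" if "x \<noteq> y"
    by (rule colouring_twins[OF assms(1)]) (use y assms that in \<open>auto simp: fibre_def\<close>)
  then show "y \<in> insert x {y. tw b (V - {v}) x y}" by blast
qed

lemma card_fibre_le:
  assumes "colouring v f" "i \<in> I b" "0 < m"
    and small: "\<And>x. x \<in> V \<Longrightarrow> card (twin_class b x) \<le> m"
    and old: "\<And>x y. tw b (V - {v}) x y \<Longrightarrow> tw b V x y"
  shows "card (fibre v f i) \<le> m"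
proof (cases "fibre v f i = {}")
  case False
  then obtain x where x: "x \<in> fibre v f i" by blast
  then have "fibre v f i \<subseteq> twin_class b x" "x \<in> V"
    using fibre_subset[OF assms(1) x assms(2)] old by (auto simp: twin_class_def fibre_def)
  then show ?thesis using small card_mono finite_twin_class le_trans by metis
qed (use assms in auto)

lemma inj_on_class:
  assumes "colouring v f"
  shows "inj_on f {x. tw b V v x}" "f ` {x. tw b V v x} \<subseteq> I (\<not> b)"
proof -
  show im: "f ` {x. tw b V v x} \<subseteq> I (\<not> b)"
    using colouring_twin_of_deleted[OF assms] by blast
  show "inj_on f {x. tw b V v x}"
  proof (rule inj_onI, rule ccontr)
    fix x y assume xy: "x \<in> {x. tw b V v x}" "y \<in> {x. tw b V v x}" "f x = f y" "x \<noteq> y"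
    then have "E x y = b" using twins_trans[of E b V x v y] twins_sym[of E b V v x] by (simp add: twins_def)
    moreover have "tw (\<not> b) (V - {v}) x y"
      using xy im by (intro colouring_twins[OF assms]) (auto simp: twins_def)
    ultimately show False by (auto simp: twins_def)
  qed
qed

lemma card_twin_class: "v \<in> V \<Longrightarrow> card (twin_class b v) = Suc (card {x. tw b V v x})"
  using finite_twin_class[of v b] unfolding twin_class_def by (subst card_insert_disjoint) (auto simp: twins_def)

lemma card_twin_class_le:
  assumes "v \<in> V" shows "card (twin_class b v) \<le> card (I (\<not> b)) + 1"
proof -
  obtain f where f: "colouring v f" using obtain_colouring assms .
  then show ?thesis using card_inj_on_le[OF inj_on_class[OF f] finite_I, of b] card_twin_class[OF assms, of b]
    by simp
qed

lemma bound_if_no_new_twins: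
  assumes v: "v \<in> V" and max: "\<And>u. u \<in> V \<Longrightarrow> card (twin_class b u) \<le> card (twin_class b v)"
    and old: "\<And>c x y. tw c (V - {v}) x y \<Longrightarrow> tw c V x y"
  shows "card V \<le> (card (I b) + 1) * (card (I (\<not> b)) + 1)"
proof -
  obtain f where f: "colouring v f" using obtain_colouring v .
  define q where "q = Max ((\<lambda>u. card (twin_class (\<not> b) u)) ` V)"
  have q: "card (twin_class (\<not> b) u) \<le> q" if "u \<in> V" for u
    unfolding q_def using that finite_V by (intro Max_ge) auto
  have "q \<in> (\<lambda>u. card (twin_class (\<not> b) u)) ` V"
    unfolding q_def using v finite_V by (intro Max_in) auto
  then obtain w where w: "w \<in> V" "q = card (twin_class (\<not> b) w)" by blast
  then have q1: "1 \<le> q" "q \<le> card (I b) + 1" using card_twin_class card_twin_class_le[of w "\<not> b"] by auto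
  define p where "p = card (twin_class b v)"
  have p1: "1 \<le> p" "p \<le> card (I (\<not> b)) + 1" using v card_twin_class card_twin_class_le p_def by auto
  define J where "J = f ` {x. tw b V v x}"
  have J: "J \<subseteq> I (\<not> b)" "card J = p - 1" "finite J"
    using inj_on_class[OF f, of b] finite_I card_twin_class[OF v] by (auto simp: J_def p_def card_image dest: finite_subset)
  have "card (fibre v f i) \<le> 1" if iJ: "i \<in> J" for i
  proof -
    obtain x where x: "i = f x" "tw b V v x" using iJ unfolding J_def by blast
    have "y = x" if "y \<in> fibre v f i" for y
    proof (rule ccontr)
      assume "y \<noteq> x"
      then have "tw (\<not> b) (V - {v}) x y" using that x J \<open>i \<in> J\<close>
        by (intro colouring_twins[OF f]) (auto simp: fibre_def twins_def)
      then have "tw (\<not> b) V x y" by (rule old)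
      then show False using x twins_sym twins_exclusive by metis
    qed
    then have "fibre v f i \<subseteq> {x}" by blast
    then show ?thesis using card_mono[of "{x}"] by fastforce
  qed
  then have "(\<Sum>i\<in>J. card (fibre v f i)) \<le> p - 1"
    using sum_le_card_mult[of J _ 1] J by simp
  moreover have "(\<Sum>i\<in>I (\<not> b) - J. card (fibre v f i)) \<le> card (I (\<not> b) - J) * q"
  proof (rule sum_le_card_mult)
    show "card (fibre v f i) \<le> q" if "i \<in> I (\<not> b) - J" for i
      using that q1 q old by (intro card_fibre_le[OF f, of i "\<not> b"]) auto
  qed
  moreover have "card (I (\<not> b) - J) = card (I (\<not> b)) - (p - 1)"
    using J by (simp add: card_Diff_subset)
  moreover have "(\<Sum>i\<in>I (\<not> b). card (fibre v f i)) =
      (\<Sum>i\<in>I (\<not> b) - J. card (fibre v f i)) + (\<Sum>i\<in>J. card (fibre v f i))"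
    using J finite_I by (intro sum.subset_diff) auto
  moreover have "(\<Sum>i\<in>I b. card (fibre v f i)) \<le> card (I b) * p"
  proof (rule sum_le_card_mult)
    show "card (fibre v f i) \<le> p" if "i \<in> I b" for i
      using that p1 max old unfolding p_def by (intro card_fibre_le[OF f, of i b]) auto
  qed
  ultimately have "card V \<le> p + ((card (I (\<not> b)) - (p - 1)) * q + card (I b) * p)"
    using card_V[OF f, of b] p1 by simp
  then show ?thesis using p1 q1 by (rule card_bound_arith)
qed

section \<open>Vertices with twins\<close>

abbreviation "bounded \<equiv> card V \<le> (card (I True) + 1) * (card (I False) + 1)"

lemma boundedI: "card V \<le> (card (I b) + 1) * (card (I (\<not> b)) + 1) \<Longrightarrow> bounded"
  by (cases b) (simp_all add: mult.commute)

lemma new_twins_of_twin: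
  assumes vv': "tw b V v v'" and xy: "tw c (V - {v}) x y" and new: "\<not> tw c V x y"
  shows "c = (\<not> b)" "x = v' \<or> y = v'"
proof -
  note sep = new_twins_separated[OF xy new]
  show *: "x = v' \<or> y = v'"
  proof (rule ccontr)
    assume n: "\<not> ?thesis"
    then have "E x v = E x v'" "E v x = E v' x" "E y v = E y v'" "E v y = E v' y"
      using vv' xy by (auto simp: twins_def)
    moreover have "v' \<in> V - {v} - {x, y}" using n vv' by (auto simp: twins_def)
    then have "E x v' = E y v'" "E v' x = E v' y" using xy unfolding twins_def by blast+
    ultimately show False using sep by simp
  qed
  have "c \<noteq> b" if "tw c (V - {v}) v' y" "E v' v \<noteq> E y v \<or> E v v' \<noteq> E v y" for y
  proof
    assume "c = b"
    moreover have "y \<in> V - {v, v'}" using that(1) by (auto simp: twins_def)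
    then have "E v y = E v' y" "E y v = E y v'" using vv' unfolding twins_def by blast+
    ultimately show False using that vv' unfolding twins_def by simp
  qed
  then show "c = (\<not> b)" using * sep xy twins_sym[OF xy] by metis
qed

lemma pair_of_max_class:
  assumes "\<not> bounded" and max: "\<And>u. u \<in> V \<Longrightarrow> card (twin_class b u) \<le> card (twin_class b v)" and vv': "tw b V v v'"
  shows "twin_class b v = {v, v'}" "\<exists>x. tw (\<not> b) (V - {v}) v' x"
proof -
  have "v \<in> V" using vv' by (simp add: twins_def)
  then obtain c x y where xy: "tw c (V - {v}) x y" "\<not> tw c V x y"
    using bound_if_no_new_twins[OF _ max] boundedI assms(1) by blast
  note D = new_twins_of_twin[OF _ xy]
  show "\<exists>x. tw (\<not> b) (V - {v}) v' x"
  proof (cases "x = v'")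
    case True
    then show ?thesis using xy(1) D(1)[OF vv'] by blast
  next
    case False
    then show ?thesis using twins_sym[OF xy(1)] D[OF vv'] by blast
  qed
  have "u = v'" if u: "tw b V v u" for u
  proof (rule ccontr)
    assume "u \<noteq> v'"
    then have "tw b V u v'" using twins_trans[OF twins_sym[OF u] vv'] by simp
    moreover have "x = u \<and> y = v' \<or> x = v' \<and> y = u"
      using D(2)[OF vv'] D(2)[OF u] \<open>u \<noteq> v'\<close> by metis
    then have "tw (\<not> b) (V - {v}) u v'"
      using xy(1) twins_sym[OF xy(1)] unfolding D(1)[OF vv'] by (elim disjE conjE) simp_all
    ultimately show False by (simp add: twins_def)
  qed
  then show "twin_class b v = {v, v'}" using vv' unfolding twin_class_def by blast
qed

lemma card_twin_class_eq_1: "u \<in> V \<Longrightarrow> (\<And>x. \<not> tw b V u x) \<Longrightarrow> card (twin_class b u) = 1"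
  by (simp add: card_twin_class)

lemma card_twin_class_ge_2:
  assumes "tw b V v v'" shows "2 \<le> card (twin_class b v)"
proof -
  have "{v, v'} \<subseteq> twin_class b v" "v \<noteq> v'" "v \<in> V" using assms by (auto simp: twin_class_def twins_def)
  then show ?thesis using card_mono[OF finite_twin_class, of v "{v, v'}" b] by simp
qed

lemma card_twin_class_le_2:
  assumes "\<not> bounded" "u \<in> V" shows "card (twin_class b u) \<le> 2"
proof -
  have fin: "finite ((\<lambda>u. card (twin_class b u)) ` V)" "(\<lambda>u. card (twin_class b u)) ` V \<noteq> {}"
    using finite_V assms by auto
  then obtain v where v: "v \<in> V" "Max ((\<lambda>u. card (twin_class b u)) ` V) = card (twin_class b v)"
    using Max_in[OF fin] by (metis (no_types, lifting) imageE)
  then have max: "card (twin_class b w) \<le> card (twin_class b v)" if "w \<in> V" for w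
    using Max_ge[OF fin(1)] that by (metis imageI)
  have "card (twin_class b v) \<le> 2"
  proof (cases "\<exists>v'. tw b V v v'")
    case True
    then obtain v' where "tw b V v v'" by blast
    then show ?thesis using pair_of_max_class(1)[OF assms(1) max] by (simp add: card_insert_if)
  next
    case False
    then show ?thesis using card_twin_class_eq_1[of v b] v by simp
  qed
  then show ?thesis using max assms le_trans by blast
qed

lemma new_twin_exists:
  assumes "\<not> bounded" "tw b V v v'"
  shows "\<exists>x. tw (\<not> b) (V - {v}) v' x"
  using pair_of_max_class(2)[OF assms(1) _ assms(2)] card_twin_class_le_2[OF assms(1)]
    card_twin_class_ge_2[OF assms(2)] le_trans by blast

lemma new_twin_is_single:
  assumes nb: "\<not> bounded" and vv': "tw b V v v'" and x: "tw (\<not> b) (V - {v}) v' x"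
  shows "\<not> tw c V x y"
proof
  assume xy: "tw c V x y"
  have v: "v \<in> V" "v' \<in> V" "v \<noteq> v'" "E v v' = b" "E v' v = b" using vv' by (auto simp: twins_def)
  have xv: "x \<in> V" "x \<noteq> v" "x \<noteq> v'" "E v' x = (\<not> b)" "E x v' = (\<not> b)"
    using x by (auto simp: twins_def)
  have vx: "E v x = (\<not> b)" "E x v = (\<not> b)"
    using vv' xv unfolding twins_def by (metis DiffI empty_iff insert_iff)+
  have y: "y \<in> V" "x \<noteq> y" "E x y = c" "E y x = c" using xy by (auto simp: twins_def)
  show False
  proof (cases "c = b")
    case True
    with y v xv vx have yv: "y \<noteq> v" "y \<noteq> v'" by auto
    have "E y v' = E x v'" using xy v xv yv unfolding twins_def by (metis DiffI empty_iff insert_iff)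
    moreover have "E y v' = E y x" using x y v xv yv unfolding twins_def
      by (metis DiffI empty_iff insert_iff)
    ultimately show False using xv y True by simp
  next
    case False
    then have c: "c = (\<not> b)" by auto
    have yv': "y \<noteq> v'" using twins_exclusive[OF twins_sym[OF vv']] twins_sym[OF xy] c by blast
    obtain z where z: "tw b (V - {x}) y z" using new_twin_exists[OF nb xy] c by auto
    have z': "z \<in> V" "z \<noteq> x" "z \<noteq> y" "E y z = b" "E z y = b" using z by (auto simp: twins_def)
    have "E y v' = (\<not> b)"
      using xy yv' xv v c unfolding twins_def by (metis DiffI empty_iff insert_iff)
    then have zv': "z \<noteq> v'" using z' by auto
    have zx: "E z x = b" using xy z' unfolding twins_def by (metis DiffI empty_iff insert_iff)
    have "z = v"
    proof (rule ccontr)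
      assume "z \<noteq> v"
      then have "E z v' = b"
        using x z' zv' zx unfolding twins_def by (metis DiffI empty_iff insert_iff)
      moreover have "E y v' = E z v'"
        using z v xv yv' zv' unfolding twins_def by (metis DiffI empty_iff insert_iff)
      ultimately show False using \<open>E y v' = (\<not> b)\<close> by simp
    qed
    then show False using zx vx by simp
  qed
qed

definition paired :: "bool \<Rightarrow> 'a set" where
  "paired b = {y. \<exists>z. tw b V y z}"

lemma paired_subset: "paired b \<subseteq> V"
  by (auto simp: paired_def twins_def)

lemma pair_fibres:
  assumes nb: "\<not> bounded" and vv': "tw b V v v'" and x: "tw (\<not> b) (V - {v}) v' x"
    and f: "colouring v f"
    and q: "\<And>u. u \<in> V \<Longrightarrow> card (twin_class (\<not> b) u) \<le> q"
  shows "i \<in> I b \<Longrightarrow> card (fibre v f i) \<le> 2"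
    and "(\<Sum>i\<in>I (\<not> b). card (fibre v f i)) \<le> 2 + (card (I (\<not> b)) - 1) * q"
proof -
  have old: "tw b V y z" if "tw b (V - {v}) y z" for y z
    using new_twins_of_twin(1)[OF vv' that] by blast
  show "i \<in> I b \<Longrightarrow> card (fibre v f i) \<le> 2"
    using card_fibre_le[OF f, of i b 2] card_twin_class_le_2[OF nb] old by simp
  have v'V: "v' \<in> V" "v' \<noteq> v" using vv' by (auto simp: twins_def)
  have j: "f v' \<in> I (\<not> b)" by (rule colouring_twin_of_deleted[OF f vv'])
  have "fibre v f (f v') \<subseteq> {v', x}"
  proof
    fix y assume y: "y \<in> fibre v f (f v')"
    show "y \<in> {v', x}"
    proof (rule ccontr)
      assume n: "y \<notin> {v', x}"
      then have "tw (\<not> b) (V - {v}) v' y"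
        using j y v'V by (intro colouring_twins[OF f]) (auto simp: fibre_def)
      then have "tw (\<not> b) (V - {v}) x y" using n twins_trans[OF twins_sym[OF x]] by blast
      moreover have "x \<noteq> v'" using x by (auto simp: twins_def)
      ultimately show False
        using n new_twin_is_single[OF nb vv' x] new_twins_of_twin(2)[OF vv'] by blast
    qed
  qed
  then have "card (fibre v f (f v')) \<le> card {v', x}" by (intro card_mono) auto
  also have "\<dots> \<le> 2" by (simp add: card_insert_if)
  finally have 1: "card (fibre v f (f v')) \<le> 2" .
  have 2: "card (fibre v f i) \<le> q" if i: "i \<in> I (\<not> b) - {f v'}" for i
  proof (cases "fibre v f i = {}")
    case False
    then obtain z where z: "z \<in> fibre v f i" by blast
    have "fibre v f i \<subseteq> twin_class (\<not> b) z"
    proof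
      fix y assume y: "y \<in> fibre v f i"
      have "tw (\<not> b) V z y" if "z \<noteq> y"
      proof (rule ccontr)
        assume "\<not> ?thesis"
        moreover have "tw (\<not> b) (V - {v}) z y"
          using i y z that by (intro colouring_twins[OF f]) (auto simp: fibre_def)
        ultimately have "z = v' \<or> y = v'" using new_twins_of_twin(2)[OF vv'] by blast
        then show False using i y z by (auto simp: fibre_def)
      qed
      then show "y \<in> twin_class (\<not> b) z" by (auto simp: twin_class_def)
    qed
    moreover have "z \<in> V" using z by (simp add: fibre_def)
    ultimately show ?thesis using q[of z] card_mono[OF finite_twin_class, of z "fibre v f i" "\<not> b"] by simp
  qed auto
  have "(\<Sum>i\<in>I (\<not> b). card (fibre v f i)) =
      card (fibre v f (f v')) + (\<Sum>i\<in>I (\<not> b) - {f v'}. card (fibre v f i))"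
    using j finite_I by (simp add: sum.remove)
  moreover have "(\<Sum>i\<in>I (\<not> b) - {f v'}. card (fibre v f i)) \<le> card (I (\<not> b) - {f v'}) * q"
    by (rule sum_le_card_mult) (rule 2)
  ultimately show "(\<Sum>i\<in>I (\<not> b). card (fibre v f i)) \<le> 2 + (card (I (\<not> b)) - 1) * q"
    using 1 j finite_I by (simp add: card_Diff_singleton)
qed

lemma pair_count:
  assumes nb: "\<not> bounded" and vv': "tw b V v v'"
    and q: "\<And>u. u \<in> V \<Longrightarrow> card (twin_class (\<not> b) u) \<le> q"
  shows "card V \<le> 2 * card (I b) + 3 + (card (I (\<not> b)) - 1) * q"
    and "card V \<le> 2 * card (I b) + 2 + (card (I (\<not> b)) - 1) * q \<or> 2 * card (I b) + 2 \<le> card (paired b)"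
proof -
  obtain x where x: "tw (\<not> b) (V - {v}) v' x" using new_twin_exists[OF nb vv'] by blast
  have "v \<in> V" using vv' by (simp add: twins_def)
  then obtain f where f: "colouring v f" using obtain_colouring by blast
  note F = pair_fibres[OF nb vv' x f, of q, OF q]
  show "card V \<le> 2 * card (I b) + 3 + (card (I (\<not> b)) - 1) * q"
    using F(2) sum_le_card_mult[of "I b" "\<lambda>i. card (fibre v f i)" 2, OF F(1)] card_V[OF f, of b] by simp
  have old: "tw b V y z" if "tw b (V - {v}) y z" for y z
    using new_twins_of_twin(1)[OF vv' that] by blast
  show "card V \<le> 2 * card (I b) + 2 + (card (I (\<not> b)) - 1) * q \<or> 2 * card (I b) + 2 \<le> card (paired b)"
  proof (cases "\<forall>i\<in>I b. card (fibre v f i) = 2")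
    case True
    let ?U = "\<Union>i\<in>I b. fibre v f i"
    have "card ?U = (\<Sum>i\<in>I b. card (fibre v f i))"
      by (intro card_UN_disjoint) (auto simp: finite_I finite_fibre, auto simp: fibre_def)
    then have U: "card ?U = 2 * card (I b)" using True by simp
    have "?U \<subseteq> paired b"
    proof
      fix y assume "y \<in> ?U"
      then obtain i where i: "i \<in> I b" "y \<in> fibre v f i" by blast
      have "\<not> fibre v f i \<subseteq> {y}" using True i card_mono[of "{y}" "fibre v f i"] by auto
      then obtain z where z: "z \<in> fibre v f i" "z \<noteq> y" by blast
      have "tw b (V - {v}) y z"
        using i z by (intro colouring_twins[OF f]) (auto simp: fibre_def)
      then show "y \<in> paired b" using old unfolding paired_def by blast
    qed
    moreover have "{v, v'} \<subseteq> paired b" using vv' twins_sym[OF vv'] unfolding paired_def by blast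
    ultimately have "card (?U \<union> {v, v'}) \<le> card (paired b)"
      by (intro card_mono finite_subset[OF paired_subset finite_V]) auto
    moreover have "?U \<inter> {v, v'} = {}"
      using colouring_twin_of_deleted[OF f vv'] not_in_both_I by (auto simp: fibre_def)
    then have "card (?U \<union> {v, v'}) = card ?U + card {v, v'}"
      by (intro card_Un_disjoint) (auto simp: finite_I finite_fibre)
    moreover have "v \<noteq> v'" using vv' by (simp add: twins_def)
    ultimately show ?thesis using U by simp
  next
    case False
    then have "(\<Sum>i\<in>I b. card (fibre v f i)) < (\<Sum>i\<in>I b. 2)"
      using F(1) by (intro sum_strict_mono_ex1 finite_I) (auto simp: order_less_le)
    then show ?thesis using F(2) card_V[OF f, of b] by simp
  qed
qed

lemma bounded_if_empty_type:
  assumes "I b = {}" shows bounded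
proof (cases "V = {}")
  case False
  have no: "\<not> tw (\<not> b) V x y" for x y
  proof
    assume xy: "tw (\<not> b) V x y"
    then have "x \<in> V" by (simp add: twins_def)
    then show False using card_twin_class_ge_2[OF xy] card_twin_class_le[of x "\<not> b"] assms by simp
  qed
  from exists_vertex_creating_no_twins[OF finite_V False no]
  obtain v where v: "v \<in> V" "\<And>x y. \<not> tw (\<not> b) (V - {v}) x y"
    by blast
  then obtain f where f: "colouring v f" using obtain_colouring by blast
  have "card (fibre v f i) \<le> 1" if "i \<in> I (\<not> b)" for i
    using that v(2) no by (intro card_fibre_le[OF f]) (auto simp: card_twin_class_eq_1)
  then have "card V \<le> card (I (\<not> b)) + 1"
    using sum_le_card_mult[of "I (\<not> b)" _ 1] card_V[OF f, of b] assms by simp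
  then show ?thesis using assms by (intro boundedI[of b]) simp
qed simp

section \<open>The bound\<close>

lemma bounded_if_twin_free:
  assumes no: "\<And>d x y. \<not> tw d V x y" shows bounded
proof (rule ccontr)
  assume nb: "\<not> bounded"
  then have "V \<noteq> {}" by auto
  from exists_vertex_creating_no_twins[OF finite_V this no]
  obtain v where v: "v \<in> V" "\<And>x y. \<not> tw True (V - {v}) x y" by blast
  then obtain f where f: "colouring v f" using obtain_colouring by blast
  have T: "card (fibre v f i) \<le> 1" if "i \<in> I True" for i
    by (rule card_fibre_le[OF f that]) (use v(2) no in \<open>simp_all add: card_twin_class_eq_1\<close>)
  have F: "card (fibre v f i) \<le> 2" if i: "i \<in> I False" for i
  proof (rule ccontr)
    assume "\<not> ?thesis"
    then have "3 \<le> card (fibre v f i)" by simp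
    moreover have "tw False (V - {v}) x y" if "x \<in> fibre v f i" "y \<in> fibre v f i" "x \<noteq> y" for x y
      using that i by (intro colouring_twins[OF f]) (auto simp: fibre_def)
    ultimately obtain x where x: "x \<in> V" "\<And>d y z. \<not> tw d (V - {x}) y z"
      using exists_irrelevant_vertex[OF no finite_fibre, of v f i False v] by blast
    have "card V \<le> (card (I True) + 1) * (card (I (\<not> True)) + 1)"
      by (rule bound_if_no_new_twins[OF x(1), of True]) (simp_all add: no x card_twin_class_eq_1)
    then show False using nb by simp
  qed
  have "card V \<le> 1 + card (I True) + 2 * card (I False)"
    using card_V[OF f, of True] sum_le_card_mult[of "I True" "\<lambda>i. card (fibre v f i)" 1, OF T]
      sum_le_card_mult[of "I False" "\<lambda>i. card (fibre v f i)" 2, OF F] by simp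
  moreover have "1 \<le> card (I True)"
    using bounded_if_empty_type[of True] nb finite_I by (auto simp: Suc_le_eq card_gt_0_iff)
  then have "card (I False) \<le> card (I True) * card (I False)" by simp
  moreover have "\<not> card V \<le> card (I True) * card (I False) + card (I True) + card (I False) + 1"
    using nb by (simp add: algebra_simps)
  ultimately show False by linarith
qed

lemma paired_disjoint: "paired b \<inter> paired (\<not> b) = {}"
  using twins_exclusive unfolding paired_def by fast

lemma twin_adjacent_to_single:
  assumes nb: "\<not> bounded" and a: "tw b V a a'" and x: "V - {x} \<subseteq> paired b"
  shows "x \<notin> paired b" "tw (\<not> b) (V - {a'}) a x"
proof -
  obtain y where y: "tw (\<not> b) (V - {a'}) a y" using new_twin_exists[OF nb twins_sym[OF a]] by blast
  have "y \<notin> paired b" using new_twin_is_single[OF nb twins_sym[OF a] y] by (simp add: paired_def)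
  moreover have "y \<in> V" using y by (simp add: twins_def)
  ultimately have "y = x" using x by blast
  then show "x \<notin> paired b" "tw (\<not> b) (V - {a'}) a x" using y \<open>y \<notin> paired b\<close> by simp_all
qed

lemma bounded_if_all_but_one_paired:
  assumes vv': "tw b V v v'" and x: "V - {x} \<subseteq> paired b" "x \<in> V" and l: "card (I (\<not> b)) = 1"
  shows bounded
proof (rule ccontr)
  assume nb: "\<not> bounded"
  note single = twin_adjacent_to_single[OF nb _ x(1)]
  have xp: "x \<notin> paired b" by (rule single(1)[OF vv'])
  \<comment> \<open>As only one part has type \<open>\<not> b\<close>, one vertex of each pair lies in a part of type \<open>b\<close>;
    moving the other one there spreads all of \<open>V - {x}\<close> over the parts of type \<open>b\<close>, two per part.\<close>
  define p where "p a = (SOME a'. tw b V a a')" for a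
  have p: "tw b V a (p a)" if "a \<in> V - {x}" for a
  proof -
    have "\<exists>a'. tw b V a a'" using that x unfolding paired_def by blast
    then show ?thesis unfolding p_def by (rule someI_ex)
  qed
  have related: "c = p a" if "a \<in> V - {x}" "c \<in> V - {x}" "c \<noteq> a" "E a c = b" for a c
  proof (rule ccontr)
    assume "c \<noteq> p a"
    then have "c \<in> V - {p a} - {a, x}" using that by blast
    then have "E a c = E x c" using single(2)[OF p[OF that(1)]] unfolding twins_def by blast
    moreover have "E x c = (\<not> b)" using single(2)[OF p[OF that(2)]] by (simp add: twins_def)
    ultimately show False using that by simp
  qed
  obtain g where g: "colouring x g" using obtain_colouring x by blast
  have px: "p a \<in> V - {x}" if "a \<in> V - {x}" for a
  proof -
    have "p a \<in> paired b" using twins_sym[OF p[OF that]] by (auto simp: paired_def)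
    then show ?thesis using xp paired_subset by blast
  qed
  have partner: "g (p a) \<in> I b" if a: "a \<in> V - {x}" "g a \<notin> I b" for a
  proof (rule ccontr)
    assume n: "g (p a) \<notin> I b"
    have "g a \<in> I (\<not> b)" using colouring_cases[OF g a(1), of b] a(2) by blast
    moreover have "g (p a) \<in> I (\<not> b)" using colouring_cases[OF g px[OF a(1)], of b] n by blast
    ultimately have "g a = g (p a)" using l by (metis card_1_singletonE singletonD)
    moreover have "a \<noteq> p a" "E a (p a) = b" using p[OF a(1)] by (simp_all add: twins_def)
    ultimately show False
      using colouring_twins[OF g \<open>g a \<in> I (\<not> b)\<close> _ a(1) px[OF a(1)]] by (simp add: twins_def)
  qed
  define r where "r a = (if g a \<in> I b then a else p a)" for a
  have r: "r a \<in> V - {x}" "g (r a) \<in> I b" "a = r a \<or> tw b V a (r a)" if "a \<in> V - {x}" for a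
    using that px p partner unfolding r_def by simp_all
  have fib: "card {a \<in> V - {x}. g (r a) = i} \<le> 2" if i: "i \<in> I b" for i
  proof (cases "\<exists>a\<in>V - {x}. g (r a) = i")
    case True
    then obtain a where a: "a \<in> V - {x}" "g (r a) = i" by blast
    have "{c \<in> V - {x}. g (r c) = i} \<subseteq> twin_class b a"
    proof
      fix c assume "c \<in> {c \<in> V - {x}. g (r c) = i}"
      then have c: "c \<in> V - {x}" "g (r c) = i" by simp_all
      have "r a = r c \<or> tw b V (r a) (r c)"
      proof (cases "r a = r c")
        case False
        then have "tw b (V - {x}) (r a) (r c)"
          using i a c r by (intro colouring_twins[OF g]) simp_all
        then have "E (r a) (r c) = b" "r c \<noteq> r a" using False by (simp_all add: twins_def)
        then have "r c = p (r a)" using related[OF r(1)[OF a(1)] r(1)[OF c(1)]] by blast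
        then show ?thesis using p[OF r(1)[OF a(1)]] by simp
      qed simp
      then have "a = c \<or> tw b V a c"
        using r(3)[OF a(1)] r(3)[OF c(1)] by (metis twins_sym twins_trans)
      then show "c \<in> twin_class b a" by (auto simp: twin_class_def)
    qed
    then show ?thesis
      using card_twin_class_le_2[OF nb, of a b] card_mono[OF finite_twin_class[of a b]] a(1) le_trans by (metis Diff_iff)
  next
    case False
    then have "{a \<in> V - {x}. g (r a) = i} = {}" by blast
    then show ?thesis by (simp only: card.empty)
  qed
  have "V - {x} = (\<Union>i\<in>I b. {a \<in> V - {x}. g (r a) = i})" using r(2) by blast
  then have "card (V - {x}) \<le> (\<Sum>i\<in>I b. card {a \<in> V - {x}. g (r a) = i})"
    using card_UN_le[OF finite_I[of b], of "\<lambda>i. {a \<in> V - {x}. g (r a) = i}"] by (simp only:)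
  also have "\<dots> \<le> card (I b) * 2" by (rule sum_le_card_mult[OF fib])
  finally have "card (V - {x}) \<le> card (I b) * 2" .
  then have "card V \<le> (card (I b) + 1) * (card (I (\<not> b)) + 1)"
    using l x(2) finite_V by (simp add: card_Diff_singleton)
  then show False using nb boundedI by blast
qed

theorem card_bound: bounded
proof (rule ccontr)
  assume nb: "\<not> bounded"
  obtain b v v' where vv': "tw b V v v'" using bounded_if_twin_free nb by blast
  define k l where "k = card (I b)" and "l = card (I (\<not> b))"
  have pos: "1 \<le> card (I c)" for c
    using bounded_if_empty_type[of c] nb finite_I by (auto simp: Suc_le_eq card_gt_0_iff)
  have kl: "1 \<le> k" "1 \<le> l" using pos by (auto simp: k_def l_def)
  have "\<not> card V \<le> (k + 1) * (l + 1)" using nb boundedI unfolding k_def l_def by blast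
  then have big: "k * l + k + l + 2 \<le> card V" by (simp add: algebra_simps)
  show False
  proof (cases "\<exists>w w'. tw (\<not> b) V w w'")
    case True
    then obtain w w' where ww': "tw (\<not> b) V w w'" by blast
    have ar: "k + l \<le> k * l + 1" using kl by (rule add_le_mult_add_1)
    have "card V \<le> 2 * k + 3 + (l - 1) * 2"
      unfolding k_def l_def by (rule pair_count(1)[OF nb vv' card_twin_class_le_2[OF nb]])
    then have V: "card V \<le> 2 * k + 2 * l + 1" using kl by (simp add: algebra_simps)
    have "card V \<le> 2 * k + 2 + (l - 1) * 2 \<or> 2 * k + 2 \<le> card (paired b)"
      unfolding k_def l_def by (rule pair_count(2)[OF nb vv' card_twin_class_le_2[OF nb]])
    then have 1: "2 * k + 2 \<le> card (paired b)" using kl ar big by (auto simp: algebra_simps)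
    have "card V \<le> 2 * l + 2 + (k - 1) * 2 \<or> 2 * l + 2 \<le> card (paired (\<not> b))"
      using pair_count(2)[OF nb ww', of 2] card_twin_class_le_2[OF nb] by (simp add: k_def l_def)
    then have 2: "2 * l + 2 \<le> card (paired (\<not> b))" using kl ar big by (auto simp: algebra_simps)
    have "card (paired b) + card (paired (\<not> b)) = card (paired b \<union> paired (\<not> b))"
      using paired_disjoint paired_subset finite_V by (metis card_Un_disjoint finite_subset)
    also have "\<dots> \<le> card V" using paired_subset finite_V by (simp add: card_mono)
    finally show False using 1 2 V by simp
  next
    case False
    then have q: "card (twin_class (\<not> b) u) \<le> 1" if "u \<in> V" for u
      using that card_twin_class_eq_1[of u "\<not> b"] by simp
    have V: "card V \<le> 2 * k + 3 + (l - 1)"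
      using pair_count(1)[OF nb vv' q] by (simp add: k_def l_def)
    have l1: "l = 1"
    proof (rule ccontr)
      assume "l \<noteq> 1"
      then obtain l' where "l = Suc (Suc l')" using kl by (metis One_nat_def Suc_le_D not0_implies_Suc)
      then show False using V big kl by (simp add: algebra_simps)
    qed
    have "card V \<le> 2 * k + 2 + (l - 1) \<or> 2 * k + 2 \<le> card (paired b)"
      using pair_count(2)[OF nb vv' q] by (simp add: k_def l_def)
    then have P: "2 * k + 2 \<le> card (paired b)" using l1 big by simp
    obtain x where x: "tw (\<not> b) (V - {v}) v' x" using new_twin_exists[OF nb vv'] by blast
    have xV: "x \<in> V" using x by (simp add: twins_def)
    have "x \<notin> paired b" using new_twin_is_single[OF nb vv' x] by (simp add: paired_def)
    then have sub: "paired b \<subseteq> V - {x}" using paired_subset by blast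
    have "card (V - {x}) \<le> card (paired b)" using V P l1 xV finite_V by simp
    then have "paired b = V - {x}" using sub finite_V by (simp add: card_seteq)
    then show False using bounded_if_all_but_one_paired[OF vv' _ xV] l1 nb by (simp add: l_def)
  qed
qed

end

section \<open>Application to matrix partitions\<close>

lemma arcs_ends_del_vert:
  "arcs_ends (pre_digraph.del_vert D v) = {(x, y) \<in> arcs_ends D. x \<noteq> v \<and> y \<noteq> v}"
  by (auto simp: arcs_ends_def arc_to_ends_def pre_digraph.del_vert_def)

lemma M_partitionable_iff:
  assumes "zero_one_mat M" "dim_col M = dim_row M" and loopfree: "\<And>x. (x, x) \<notin> arcs_ends D"
  shows "M_partitionable M D \<longleftrightarrow> (\<exists>f. (\<forall>x\<in>verts D. f x < dim_row M) \<and>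
    (\<forall>x\<in>verts D. \<forall>y\<in>verts D. x \<noteq> y \<longrightarrow> ((x, y) \<in> arcs_ends D \<longleftrightarrow> M $$ (f x, f y) = 1)))"
    (is "_ \<longleftrightarrow> (\<exists>f. ?P f)")
proof
  have M01: "M $$ (i, j) = 0 \<or> M $$ (i, j) = 1" if "i < dim_row M" "j < dim_row M" for i j
    using assms that by (auto simp: zero_one_mat_def)
  {
    assume "M_partitionable M D"
    then obtain V where V: "M_partition M D V" by (auto simp: M_partitionable_def)
    then have "\<forall>x\<in>verts D. \<exists>i. i < dim_row M \<and> x \<in> V i" unfolding M_partition_def by blast
    from bchoice[OF this]
    obtain f where f: "\<And>x. x \<in> verts D \<Longrightarrow> f x < dim_row M \<and> x \<in> V (f x)" by blast
    have "(x, y) \<in> arcs_ends D \<longleftrightarrow> M $$ (f x, f y) = 1" if "x \<in> verts D" "y \<in> verts D" "x \<noteq> y" for x y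
    proof (cases "f x = f y")
      case True
      have "y \<in> V (f x)" using f[OF that(2)] True by simp
      moreover have "M $$ (f x, f x) = 0 \<longrightarrow> independent_set D (V (f x))"
        "M $$ (f x, f x) = 1 \<longrightarrow> strong_clique D (V (f x))"
        using V f[OF that(1)] unfolding M_partition_def by blast+
      ultimately show ?thesis
        using that f[OF that(1)] M01[of "f x" "f x"] unfolding True[symmetric]
        by (auto simp: independent_set_def strong_clique_def)
    next
      case False
      then have "M $$ (f x, f y) = 0 \<longrightarrow> completely_nonadjacent D (V (f x)) (V (f y))"
        "M $$ (f x, f y) = 1 \<longrightarrow> completely_adjacent D (V (f x)) (V (f y))"
        using V f[OF that(1)] f[OF that(2)] unfolding M_partition_def by blast+
      then show ?thesis
        using f[OF that(1)] f[OF that(2)] M01[of "f x" "f y"]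
        by (auto simp: completely_adjacent_def completely_nonadjacent_def)
    qed
    then show "\<exists>f. ?P f" using f by blast
  }
  assume "\<exists>f. ?P f"
  then obtain f where f: "\<And>x. x \<in> verts D \<Longrightarrow> f x < dim_row M"
    and arc: "\<And>x y. x \<in> verts D \<Longrightarrow> y \<in> verts D \<Longrightarrow> x \<noteq> y \<Longrightarrow>
      (x, y) \<in> arcs_ends D \<longleftrightarrow> M $$ (f x, f y) = 1" by blast
  have arc0: "(x, y) \<notin> arcs_ends D"
    if "x \<in> verts D" "y \<in> verts D" "M $$ (f x, f y) = 0" for x y
    using arc[OF that(1,2)] that(3) loopfree by (cases "x = y") auto
  have "M_partition M D (\<lambda>i. {x \<in> verts D. f x = i})"
    unfolding M_partition_def independent_set_def strong_clique_def completely_adjacent_def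
      completely_nonadjacent_def
    using f arc arc0 by (auto simp: disjoint_family_on_def)
  then show "M_partitionable M D" by (auto simp: M_partitionable_def)
qed

theorem theorem4:
  fixes M :: "nat mat" and k l :: nat and D :: "('a, 'b) pre_digraph"
  assumes "M \<in> carrier_mat (k + l) (k + l)"
    and "zero_one_mat M"
    and "card {i. i < k + l \<and> M $$ (i, i) = 0} = k"
    and "card {i. i < k + l \<and> M $$ (i, i) = 1} = l"
    and "minimal_M_obstruction M D"
  shows "card (verts D) \<le> (k + 1) * (l + 1)"
proof -
  let ?E = "\<lambda>x y. (x, y) \<in> arcs_ends D"
  let ?I = "\<lambda>b. {i. i < k + l \<and> M $$ (i, i) = (if b then 1 else 0)}"
  have dim: "dim_row M = k + l" "dim_col M = k + l" using assms(1) by auto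
  have "digraph D" using assms(5) by (simp add: minimal_M_obstruction_def)
  then interpret digraph D .
  have loopfree: "(x, x) \<notin> arcs_ends D" for x
    using adj_not_same[of x] by auto
  note part_D = M_partitionable_iff[OF assms(2), of D, unfolded dim, OF refl loopfree]
  interpret obstruction ?E "verts D" ?I
  proof
    fix v assume v: "v \<in> verts D"
    let ?W = "verts D - {v}"
    have "M_partitionable M (del_vert v)"
      using assms(5) v by (simp add: minimal_M_obstruction_def)
    then have "\<exists>f. (\<forall>x\<in>?W. f x < k + l) \<and>
      (\<forall>x\<in>?W. \<forall>y\<in>?W. x \<noteq> y \<longrightarrow> (?E x y \<longleftrightarrow> M $$ (f x, f y) = 1))"
      using M_partitionable_iff[OF assms(2), of "del_vert v"] loopfree
      by (simp add: dim verts_del_vert arcs_ends_del_vert)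
    then obtain f where f: "\<And>x. x \<in> ?W \<Longrightarrow> f x < k + l"
      and arc: "\<And>x y. x \<in> ?W \<Longrightarrow> y \<in> ?W \<Longrightarrow> x \<noteq> y \<Longrightarrow> ?E x y \<longleftrightarrow> M $$ (f x, f y) = 1"
      by blast
    have diag: "M $$ (i, i) = 1 \<longleftrightarrow> b" if "i \<in> ?I b" for i b
      using that by (cases b) auto
    have "\<exists>b. f x \<in> ?I b" if "x \<in> ?W" for x
    proof -
      have "M $$ (f x, f x) = 0 \<or> M $$ (f x, f x) = 1"
        using assms(2) f[OF that] by (auto simp: zero_one_mat_def dim)
      then show ?thesis
        using f[OF that] by (intro exI[of _ "M $$ (f x, f x) = 1"]) auto
    qed
    moreover have "twins ?E b ?W x y"
      if "f x \<in> ?I b" "f x = f y" "x \<in> ?W" "y \<in> ?W" "x \<noteq> y" for b x y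
    proof -
      have "?E x y = b" "?E y x = b"
        using arc[OF that(3,4)] arc[OF that(4,3)] that(5) diag[OF that(1)] by (simp_all flip: that(2))
      moreover have "?E x z = ?E y z \<and> ?E z x = ?E z y" if z: "z \<in> ?W - {x, y}" for z
      proof -
        have "z \<in> ?W" "x \<noteq> z" "y \<noteq> z" using z by blast+
        then show ?thesis using arc \<open>x \<in> ?W\<close> \<open>y \<in> ?W\<close> \<open>f x = f y\<close> by metis
      qed
      ultimately show ?thesis using that unfolding twins_def by blast
    qed
    moreover have "\<not> twins ?E b (verts D) v x" if x: "x \<in> ?W" "f x \<in> ?I b" for b x
    proof
      assume tw: "twins ?E b (verts D) v x"
      define g where "g = f(v := f x)"
      have g: "g v = f x" "\<And>y. y \<noteq> v \<Longrightarrow> g y = f y" by (simp_all add: g_def)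
      have gv: "(?E v y \<longleftrightarrow> M $$ (f x, f y) = 1) \<and> (?E y v \<longleftrightarrow> M $$ (f y, f x) = 1)"
        if y: "y \<in> ?W" for y
      proof (cases "y = x")
        case True
        then show ?thesis using tw diag[OF x(2)] by (simp add: twins_def)
      next
        case False
        then have "y \<in> verts D - {v, x}" using y by blast
        then have "?E v y = ?E x y \<and> ?E y v = ?E y x" using tw unfolding twins_def by blast
        then show ?thesis using arc[OF x(1) y] arc[OF y x(1)] False by simp
      qed
      have "g y < k + l" if "y \<in> verts D" for y
        using that f[OF x(1)] f[of y] by (simp add: g_def)
      moreover have "?E y z \<longleftrightarrow> M $$ (g y, g z) = 1" if "y \<in> verts D" "z \<in> verts D" "y \<noteq> z" for y z
        using that arc[of y z] gv[of y] gv[of z] by (cases "y = v"; cases "z = v") (simp_all add: g)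
      ultimately have "M_partitionable M D" unfolding part_D by blast
      then show False using assms(5) by (simp add: minimal_M_obstruction_def)
    qed
    ultimately show "\<exists>f. (\<forall>x\<in>?W. \<exists>b. f x \<in> ?I b) \<and>
      (\<forall>b x y. f x \<in> ?I b \<longrightarrow> f x = f y \<longrightarrow> x \<in> ?W \<longrightarrow> y \<in> ?W \<longrightarrow> x \<noteq> y \<longrightarrow> twins ?E b ?W x y) \<and>
      (\<forall>b x. x \<in> ?W \<longrightarrow> f x \<in> ?I b \<longrightarrow> \<not> twins ?E b (verts D) v x)"
      by blast
  qed auto
  show ?thesis using card_bound assms(3,4) by (simp add: mult.commute)
qed

end
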